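(* Let $\gamma:S^1\rightarrow X$ be a generic closed front. Then the zigzag number $z(\gamma)$ of $\gamma$ equals the rotation number of $k_\gamma$.
   Context: Let $(X,\|\cdot\|)$ be a two-dimensional real normed space with unit circle $S=\{x\in X:\|x\|=1\}$. The plane is assumed smooth ($S$ is a smooth curve) and strictly convex ($S$ contains no line segment). Fix a nondegenerate symplectic (alternating) bilinear form $[\cdot,\cdot]$ on $X$. For $x,y\in X$, $x\dashv_B y$ (Birkhoff orthogonality) means $\|x+ty\|\ge\|x\|$ for all $t\in\mathbb{R}$. For $v\in X\setminus\{o\}$ let $b(v)\in S$ be the unique vector with $v\dashv_B b(v)$ and $[v,b(v)]>0$. Write $S^1=\mathbb{R}/\mathbb{Z}$. A closed front is a smooth map $\gamma:S^1\to X$ for which there is a smooth $\eta:S^1\to S$ with $\eta(t)\dashv_B\gamma'(t)$ for all $t$ and such that $\gamma'$ and $\eta'$ never vanish simultaneously; $(\gamma,\eta)$ is then called a Legendre immersion. Put $\xi=b\circ\eta$; its curvature is the pair of smooth functions $(\alpha,\kappa)$ with $\gamma'=\alpha\xi$, $\eta'=\kappa\xi$. A singular point is a $t_0$ with $\gamma'(t_0)=0$; it is an ordinary cusp if moreover $\gamma''(t_0),\gamma'''(t_0)$ are linearly independent. The closed front is generic if all its singular points are ordinary cusps and all its self-intersections are double points, i.e. whenever $t_0\ne t_1$ and $\gamma(t_0)=\gamma(t_1)$, the vectors $\eta(t_0),\eta(t_1)$ are linearly independent. An ordinary cusp $t_0$ is a zig if $[\eta(t_0),\eta'(t_0)]>0$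 and a zag if $[\eta(t_0),\eta'(t_0)]<0$. Let $t_1<\dots<t_m$ be the ordered ordinary cusps of $\gamma$; $m$ is even. Form the word of length $m$ whose $j$-th letter is $a$ if $t_j$ is a zig and $b$ if $t_j$ is a zag. In the free product $\mathbb{Z}_2*\mathbb{Z}_2$ (with the reduction $a^2=b^2=1$) this word is of the form $(ab)^k$ or $(ba)^k$; the number $z(\gamma):=k$ is called the Maslov index (or zigzag number) of $\gamma$. Let $\mathrm{P}^1(\mathbb{R})$ be the real projective line, with coordinates $[x:y]$ defined as $y/x$, and let $k_\gamma:S^1\to\mathrm{P}^1(\mathbb{R})$ be the smooth map $k_\gamma(t)=[\alpha(t):\kappa(t)]$. Identifying $\mathrm{P}^1(\mathbb{R})$ canonically with the one-dimensional circle, the rotation number of $k_\gamma$ is defined as its absolute number of (complete) turns over the circle, counted with sign depending on the orientation.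
   Formalization: The rotation number counts a complete turn as a rotation of the line [α:κ] by the full angle 2π, which traverses P¹(R) twice; it is thus half the absolute degree of k_γ into P¹(R). With one traversal counted as a turn, the claim is off by a factor 2. *)

theory Defs
  imports "HOL-Analysis.Analysis"
begin

section \<open>Smooth curves\<close>

text \<open>Maps on the circle \<open>\<real>/\<int>\<close> are represented by functions on \<open>\<real>\<close> of period 1.\<close>

definition periodic1 :: "(real \<Rightarrow> 'b) \<Rightarrow> bool" where
  "periodic1 f \<longleftrightarrow> (\<forall>t. f (t + 1) = f t)"

definition vderiv :: "(real \<Rightarrow> 'a::real_normed_vector) \<Rightarrow> real \<Rightarrow> 'a" where
  "vderiv f = (\<lambda>t. vector_derivative f (at t))"

definition smooth_curve :: "(real \<Rightarrow> 'a::real_normed_vector) \<Rightarrow> bool" where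
  "smooth_curve f \<longleftrightarrow> (\<forall>n t. (vderiv ^^ n) f differentiable (at t))"

definition lin_indep2 :: "'a::real_vector \<Rightarrow> 'a \<Rightarrow> bool" where
  "lin_indep2 u v \<longleftrightarrow> u \<noteq> v \<and> independent {u, v}"

section \<open>Normed planes\<close>

text \<open>The norm is that of the type class \<open>real_normed_vector\<close>, so it is arbitrary. Since \<open>dim\<close> is 0
  for an infinite-dimensional space, \<open>dim UNIV = 2\<close> does force dimension two.\<close>

definition normed_plane :: "'a::real_normed_vector itself \<Rightarrow> bool" where
  "normed_plane _ \<longleftrightarrow> dim (UNIV :: 'a set) = 2"

definition smooth_plane :: "'a::real_normed_vector itself \<Rightarrow> bool" where
  "smooth_plane _ \<longleftrightarrow>
     (\<exists>\<sigma> :: real \<Rightarrow> 'a. periodic1 \<sigma> \<and> smooth_curve \<sigma> \<and> (\<forall>t. vderiv \<sigma> t \<noteq> 0) \<and>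
        inj_on \<sigma> {0..<1} \<and> range \<sigma> = sphere 0 1)"

definition strictly_convex_plane :: "'a::real_normed_vector itself \<Rightarrow> bool" where
  "strictly_convex_plane _ \<longleftrightarrow>
     (\<forall>x y :: 'a. x \<noteq> y \<longrightarrow> \<not> closed_segment x y \<subseteq> sphere 0 1)"

definition symplectic_form :: "('a::real_vector \<Rightarrow> 'a \<Rightarrow> real) \<Rightarrow> bool" where
  "symplectic_form \<omega> \<longleftrightarrow>
     bilinear \<omega> \<and> (\<forall>x. \<omega> x x = 0) \<and> (\<forall>x. (\<forall>y. \<omega> x y = 0) \<longrightarrow> x = 0)"

definition birkhoff_orth :: "'a::real_normed_vector \<Rightarrow> 'a \<Rightarrow> bool" where
  "birkhoff_orth x y \<longleftrightarrow> (\<forall>t::real. norm (x + t *\<^sub>R y) \<ge> norm x)"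

definition bvec :: "('a::real_normed_vector \<Rightarrow> 'a \<Rightarrow> real) \<Rightarrow> 'a \<Rightarrow> 'a" where
  "bvec \<omega> v = (THE w. w \<in> sphere 0 1 \<and> birkhoff_orth v w \<and> \<omega> v w > 0)"

section \<open>Fronts\<close>

definition legendre_immersion ::
    "(real \<Rightarrow> 'a::real_normed_vector) \<Rightarrow> (real \<Rightarrow> 'a) \<Rightarrow> bool" where
  "legendre_immersion \<gamma> \<eta> \<longleftrightarrow>
     periodic1 \<gamma> \<and> smooth_curve \<gamma> \<and> periodic1 \<eta> \<and> smooth_curve \<eta> \<and>
     (\<forall>t. \<eta> t \<in> sphere 0 1) \<and>
     (\<forall>t. birkhoff_orth (\<eta> t) (vderiv \<gamma> t)) \<and>
     (\<forall>t. \<not> (vderiv \<gamma> t = 0 \<and> vderiv \<eta> t = 0))"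

definition xi :: "('a::real_normed_vector \<Rightarrow> 'a \<Rightarrow> real) \<Rightarrow> (real \<Rightarrow> 'a) \<Rightarrow> real \<Rightarrow> 'a" where
  "xi \<omega> \<eta> t = bvec \<omega> (\<eta> t)"

definition curv_alpha ::
    "('a::real_normed_vector \<Rightarrow> 'a \<Rightarrow> real) \<Rightarrow> (real \<Rightarrow> 'a) \<Rightarrow> (real \<Rightarrow> 'a) \<Rightarrow> real \<Rightarrow> real" where
  "curv_alpha \<omega> \<gamma> \<eta> t = (THE c. vderiv \<gamma> t = c *\<^sub>R xi \<omega> \<eta> t)"

definition curv_kappa ::
    "('a::real_normed_vector \<Rightarrow> 'a \<Rightarrow> real) \<Rightarrow> (real \<Rightarrow> 'a) \<Rightarrow> real \<Rightarrow> real" where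
  "curv_kappa \<omega> \<eta> t = (THE c. vderiv \<eta> t = c *\<^sub>R xi \<omega> \<eta> t)"

definition singular_point :: "(real \<Rightarrow> 'a::real_normed_vector) \<Rightarrow> real \<Rightarrow> bool" where
  "singular_point \<gamma> t \<longleftrightarrow> vderiv \<gamma> t = 0"

definition ordinary_cusp :: "(real \<Rightarrow> 'a::real_normed_vector) \<Rightarrow> real \<Rightarrow> bool" where
  "ordinary_cusp \<gamma> t \<longleftrightarrow>
     singular_point \<gamma> t \<and> lin_indep2 ((vderiv ^^ 2) \<gamma> t) ((vderiv ^^ 3) \<gamma> t)"

definition generic_front ::
    "(real \<Rightarrow> 'a::real_normed_vector) \<Rightarrow> (real \<Rightarrow> 'a) \<Rightarrow> bool" where
  "generic_front \<gamma> \<eta> \<longleftrightarrow>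
     (\<forall>t. singular_point \<gamma> t \<longrightarrow> ordinary_cusp \<gamma> t) \<and>
     (\<forall>t0\<in>{0..<1}. \<forall>t1\<in>{0..<1}. t0 \<noteq> t1 \<longrightarrow> \<gamma> t0 = \<gamma> t1 \<longrightarrow> lin_indep2 (\<eta> t0) (\<eta> t1))"

section \<open>The zigzag number\<close>

datatype letter = La | Lb

text \<open>Two words are related iff they represent the same element of
  \<open>\<int>\<^sub>2 * \<int>\<^sub>2 = \<langle>a, b | a\<^sup>2 = b\<^sup>2 = 1\<rangle>\<close>; as the generators are their own inverses, every element is
  represented by a word in \<open>a\<close> and \<open>b\<close>.\<close>

inductive word_eq :: "letter list \<Rightarrow> letter list \<Rightarrow> bool" where
  cancel: "word_eq (u @ [x, x] @ v) (u @ v)"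
| refl: "word_eq u u"
| sym: "word_eq u v \<Longrightarrow> word_eq v u"
| trans: "word_eq u v \<Longrightarrow> word_eq v w \<Longrightarrow> word_eq u w"

definition word_power :: "letter list \<Rightarrow> nat \<Rightarrow> letter list" where
  "word_power w k = concat (replicate k w)"

definition zig ::
    "('a::real_normed_vector \<Rightarrow> 'a \<Rightarrow> real) \<Rightarrow> (real \<Rightarrow> 'a) \<Rightarrow> real \<Rightarrow> bool" where
  "zig \<omega> \<eta> t \<longleftrightarrow> \<omega> (\<eta> t) (vderiv \<eta> t) > 0"

text \<open>At a cusp of a front \<open>\<omega> (\<eta> t) (\<eta>' t)\<close> is nonzero, so a cusp that is not a zig is a zag.\<close>

definition cusp_word ::
    "('a::real_normed_vector \<Rightarrow> 'a \<Rightarrow> real) \<Rightarrow> (real \<Rightarrow> 'a) \<Rightarrow> (real \<Rightarrow> 'a) \<Rightarrow> letter list" where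
  "cusp_word \<omega> \<gamma> \<eta> =
     map (\<lambda>t. if zig \<omega> \<eta> t then La else Lb)
       (sorted_list_of_set {t \<in> {0..<1}. ordinary_cusp \<gamma> t})"

definition zigzag_number ::
    "('a::real_normed_vector \<Rightarrow> 'a \<Rightarrow> real) \<Rightarrow> (real \<Rightarrow> 'a) \<Rightarrow> (real \<Rightarrow> 'a) \<Rightarrow> nat" where
  "zigzag_number \<omega> \<gamma> \<eta> =
     (THE k. word_eq (cusp_word \<omega> \<gamma> \<eta>) (word_power [La, Lb] k) \<or>
             word_eq (cusp_word \<omega> \<gamma> \<eta>) (word_power [Lb, La] k))"

section \<open>The rotation number\<close>

text \<open>A point of the real projective line is a line through the origin of \<open>\<real>\<^sup>2\<close>.\<close>

definition proj_point :: "real \<Rightarrow> real \<Rightarrow> (real \<times> real) set" where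
  "proj_point x y = span {(x, y)}"

definition k_map ::
    "('a::real_normed_vector \<Rightarrow> 'a \<Rightarrow> real) \<Rightarrow> (real \<Rightarrow> 'a) \<Rightarrow> (real \<Rightarrow> 'a) \<Rightarrow> real \<Rightarrow> (real \<times> real) set" where
  "k_map \<omega> \<gamma> \<eta> t = proj_point (curv_alpha \<omega> \<gamma> \<eta> t) (curv_kappa \<omega> \<eta> t)"

text \<open>The line \<open>[cos \<theta> : sin \<theta>]\<close> is identified with the point of the circle at angle \<open>\<theta>\<close>, and a
  complete turn is an increase of \<open>\<theta>\<close> by \<open>2 * pi\<close>, i.e. a turn of the line through a full angle.
  Since \<open>\<theta>\<close> and \<open>\<theta> + pi\<close> give the same line, a complete turn traverses the projective line
  twice, so the rotation number is half the absolute topological degree of the map into it.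
  With this normalisation a front with cusp word \<open>ab\<close> has rotation number 1: its vector
  \<open>(\<alpha>, \<kappa>)\<close> winds once around the origin, meeting the vertical axis once on either side.\<close>

definition rotation_number :: "(real \<Rightarrow> (real \<times> real) set) \<Rightarrow> real" where
  "rotation_number k =
     (THE r. \<exists>\<theta> :: real \<Rightarrow> real. continuous_on {0..1} \<theta> \<and>
        (\<forall>t\<in>{0..1}. k t = proj_point (cos (\<theta> t)) (sin (\<theta> t))) \<and>
        r = \<bar>\<theta> 1 - \<theta> 0\<bar> / (2 * pi))"

end

theory Submission
  imports Defs
begin

text \<open>
  Pair the derivatives of the front with the normal \<open>\<eta>\<close>: put \<open>A = \<omega> \<eta> \<gamma>'\<close> and \<open>K = \<omega> \<eta> \<eta>'\<close>.
  Since \<open>\<gamma>' = \<alpha> \<xi>\<close> and \<open>\<eta>' = \<kappa> \<xi>\<close>, one has \<open>(A, K) = \<omega> \<eta> \<xi> \<cdot> (\<alpha>, \<kappa>)\<close> with \<open>\<omega> \<eta> \<xi> > 0\<close>. So \<open>(A, K)\<close>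
  describes the same point \<open>k_map\<close> of the projective line, its zeros and signs are those of the
  curvature, and it is visibly differentiable, whereas the regularity of \<open>\<xi>\<close> would first have to be
  extracted from the smoothness of the unit circle.  It is a loop in the plane that avoids the
  origin; the cusps are its crossings of the vertical axis, these are transverse because \<open>\<gamma>''\<close> does
  not vanish at an ordinary cusp, and a cusp is a zig when the crossing lies on the upper half of
  the axis and a zag when it lies on the lower half.

  Both numbers in question are determined by one integer, the alternating sum
  \<open>\<epsilon>\<^sub>1 - \<epsilon>\<^sub>2 + \<epsilon>\<^sub>3 - \<dots>\<close> of the signs of the crossings (zig \<open>= 1\<close>, zag \<open>= -1\<close>).

  On words, cancelling two equal adjacent letters does not change the alternating sum
  (\<open>word_eq_alternating_sum\<close>), and it takes the value \<open>2 k\<close> on \<open>(ab)\<^sup>k\<close> and \<open>- 2 k\<close> on \<open>(ba)\<^sup>k\<close>.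
  Every word of even length reduces to one of these, so its zigzag number is half the absolute
  value of the alternating sum (\<open>even_word_reduced_length\<close>).

  On loops, let \<open>\<theta>\<close> be a continuous angle of \<open>(A, K)\<close>.  Between consecutive crossings the loop stays
  in one of the half planes \<open>A \<ge> 0\<close>, \<open>A \<le> 0\<close>, hence turns by half a turn if the two crossings have
  different signs and by none if they have the same sign; the direction is given by the half plane,
  which alternates because the crossings are transverse (\<open>turn_between_zeros\<close>).  Summation by parts
  over one period shows that the total turn is \<open>\<plusminus> pi\<close> times the alternating sum
  (\<open>rotation_number_crossing_word\<close>).
\<close>

section \<open>Words in the infinite dihedral group\<close>

primrec letter_sign :: "letter \<Rightarrow> int" where
  "letter_sign La = 1"
| "letter_sign Lb = -1"

primrec alternating_sum :: "letter list \<Rightarrow> int" where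
  "alternating_sum [] = 0"
| "alternating_sum (x # w) = letter_sign x - alternating_sum w"

lemma alternating_sum_append:
  "alternating_sum (u @ v) = alternating_sum u + (-1) ^ length u * alternating_sum v"
  by (induction u) auto

text \<open>In a cancelled pair the two equal letters stand in adjacent positions and so enter with opposite
  signs; removing two letters leaves the parity of all later positions unchanged.\<close>

lemma word_eq_alternating_sum:
  assumes "word_eq u v"
  shows "alternating_sum u = alternating_sum v"
  using assms by induction (simp_all add: alternating_sum_append)

lemma word_power_Suc: "word_power w (Suc k) = w @ word_power w k"
  by (simp add: word_power_def)

lemma alternating_sum_word_power:
  "alternating_sum (word_power [La, Lb] k) = 2 * int k"
  "alternating_sum (word_power [Lb, La] k) = - 2 * int k"
  by (induction k) (simp_all add: word_power_Suc, simp_all add: word_power_def)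

lemma word_eq_append_left:
  assumes "word_eq u v"
  shows "word_eq (p @ u) (p @ v)"
  using assms
proof induction
  case (cancel u x v)
  show ?case
    using word_eq.cancel[of "p @ u" x v] by simp
qed (blast intro: word_eq.intros)+

lemma even_word_normal_form:
  assumes "even (length w)"
  shows "\<exists>k. word_eq w (word_power [La, Lb] k) \<or> word_eq w (word_power [Lb, La] k)"
  using assms
proof (induction w rule: induct_list012)
  case 1
  have "word_eq [] (word_power [La, Lb] 0)"
    by (simp add: word_power_def word_eq.refl)
  then show ?case by blast
next
  case (2 x)
  then show ?case by simp
next
  case (3 x y w)
  then obtain k where k:
    "word_eq w (word_power [La, Lb] k) \<or> word_eq w (word_power [Lb, La] k)"
    by auto
  have prefix: "word_eq (x # y # w) (x # y # v)" if "word_eq w v" for v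
    using word_eq_append_left[OF that, of "[x, y]"] by simp
  \<comment> \<open>The prefix \<open>xy\<close> either lengthens the normal form by one block or, being the inverse of the
    first block, cancels it.\<close>
  have absorb: "\<exists>k. word_eq (p # q # w) (word_power [p, q] k) \<or>
      word_eq (p # q # w) (word_power [q, p] k)"
    if pre: "\<And>v. word_eq w v \<Longrightarrow> word_eq (p # q # w) (p # q # v)"
      and nf: "word_eq w (word_power [p, q] k) \<or> word_eq w (word_power [q, p] k)" for p q
    using nf
  proof
    assume "word_eq w (word_power [p, q] k)"
    from pre[OF this] have "word_eq (p # q # w) (word_power [p, q] (Suc k))"
      by (simp add: word_power_Suc)
    then show ?thesis by blast
  next
    assume inverse: "word_eq w (word_power [q, p] k)"
    show ?thesis
    proof (cases k)
      case 0
      with pre[OF inverse] have "word_eq (p # q # w) (word_power [p, q] (Suc 0))"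
        by (simp add: word_power_def)
      then show ?thesis by blast
    next
      case (Suc j)
      have "word_eq (p # q # q # p # word_power [q, p] j) (p # p # word_power [q, p] j)"
        using word_eq.cancel[of "[p]" q "p # word_power [q, p] j"] by simp
      moreover have "word_eq (p # p # word_power [q, p] j) (word_power [q, p] j)"
        using word_eq.cancel[of "[]" p "word_power [q, p] j"] by simp
      moreover have "word_eq (p # q # w) (p # q # q # p # word_power [q, p] j)"
        using pre[OF inverse] Suc by (simp add: word_power_Suc)
      ultimately have "word_eq (p # q # w) (word_power [q, p] j)"
        by (blast intro: word_eq.trans)
      then show ?thesis by blast
    qed
  qed
  show ?case
  proof (cases "x = y")
    case True
    then have "word_eq (x # y # w) w"
      using word_eq.cancel[of "[]" x w] by simp
    then show ?thesis
      using k by (blast intro: word_eq.trans)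
  next
    case False
    then consider "x = La" "y = Lb" | "x = Lb" "y = La"
      by (cases x; cases y) auto
    then show ?thesis
      using absorb[of x y] prefix k by cases blast+
  qed
qed

lemma even_word_reduced_length:
  assumes "even (length w)"
  shows "2 * int (THE k. word_eq w (word_power [La, Lb] k) \<or> word_eq w (word_power [Lb, La] k))
    = \<bar>alternating_sum w\<bar>"
proof -
  define P where
    "P k \<longleftrightarrow> word_eq w (word_power [La, Lb] k) \<or> word_eq w (word_power [Lb, La] k)" for k
  have P: "2 * int k = \<bar>alternating_sum w\<bar>" if "P k" for k
    using that unfolding P_def
    by (auto dest!: word_eq_alternating_sum simp: alternating_sum_word_power)
  obtain k where k: "P k"
    using even_word_normal_form[OF assms] P_def by blast
  have "(THE k. P k) = k"
  proof (rule the_equality)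
    show "P k" by (rule k)
    show "j = k" if "P j" for j
      using P[OF that] P[OF k] by linarith
  qed
  then show ?thesis
    using P[OF k] unfolding P_def by simp
qed

section \<open>Angles of lines\<close>

lemma proj_point_scale:
  assumes "c \<noteq> 0"
  shows "proj_point (c * x) (c * y) = proj_point x y"
proof -
  have "span {c *\<^sub>R (x, y)} = span {(x, y)}"
  proof (rule span_eq[THEN iffD2], intro conjI)
    show "{c *\<^sub>R (x, y)} \<subseteq> span {(x, y)}"
      by (simp only: insert_subset empty_subsetI) (simp only: span_scale span_base insertI1 simp_thms)
    have "(x, y) = (1 / c) *\<^sub>R (c *\<^sub>R (x, y))"
      using assms by simp
    also have "\<dots> \<in> span {c *\<^sub>R (x, y)}"
      by (intro span_scale span_base) simp
    finally show "{(x, y)} \<subseteq> span {c *\<^sub>R (x, y)}"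
      by simp
  qed
  then show ?thesis
    by (simp add: proj_point_def)
qed

text \<open>Two angles of the same line differ by a multiple of \<open>pi\<close>. This is expressed by the vanishing of
  a sine, to which the next lemma applies.\<close>

lemma proj_point_angle_eq_imp:
  assumes "proj_point (cos s) (sin s) = proj_point (cos t) (sin t)"
  shows "sin (s - t) = 0"
proof -
  have "(cos s, sin s) \<in> span {(cos t, sin t)}"
    using assms unfolding proj_point_def by (metis insertI1 span_base)
  then obtain c where "cos s = c * cos t" "sin s = c * sin t"
    by (auto simp: span_singleton)
  then show ?thesis
    by (simp add: sin_diff)
qed

text \<open>A continuous function with values in the discrete set \<open>pi \<cdot> \<int>\<close> is constant on connected sets.
  All comparisons of angles below rest on this.\<close>

lemma sin_zero_constant:
  fixes f :: "real \<Rightarrow> real"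
  assumes "connected S" "continuous_on S f" "\<And>x. x \<in> S \<Longrightarrow> sin (f x) = 0" "x \<in> S" "y \<in> S"
  shows "f x = f y"
proof -
  have "f constant_on S"
  proof (rule continuous_discrete_range_constant[OF assms(1,2)])
    fix x assume x: "x \<in> S"
    have "pi \<le> norm (f y - f x)" if y: "y \<in> S" "f y \<noteq> f x" for y
    proof -
      obtain i j :: int where ij: "f x = of_int i * pi" "f y = of_int j * pi"
        using assms(3) x y sin_zero_iff_int2 by metis
      with y have "1 \<le> \<bar>j - i\<bar>" by auto
      then have "1 \<le> \<bar>real_of_int (j - i)\<bar>" by linarith
      moreover have "norm (f y - f x) = \<bar>real_of_int (j - i)\<bar> * pi"
        by (simp add: ij abs_mult flip: left_diff_distrib)
      ultimately show ?thesis by simp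
    qed
    then show "\<exists>e>0. \<forall>y. y \<in> S \<and> f y \<noteq> f x \<longrightarrow> e \<le> norm (f y - f x)"
      using pi_gt_zero by blast
  qed
  then show ?thesis
    using assms(4,5) unfolding constant_on_def by metis
qed

text \<open>Any two angle functions of the same family of lines differ by a constant, so the description
  that defines the rotation number determines it, and any angle function computes it.\<close>

lemma rotation_number_eqI:
  assumes cont: "continuous_on {0..1} \<theta>"
    and lift: "\<And>t. t \<in> {0..1} \<Longrightarrow> k t = proj_point (cos (\<theta> t)) (sin (\<theta> t))"
  shows "rotation_number k = \<bar>\<theta> 1 - \<theta> 0\<bar> / (2 * pi)"
  unfolding rotation_number_def
proof (rule the_equality)
  show "\<exists>\<theta>'. continuous_on {0..1} \<theta>' \<and>
      (\<forall>t\<in>{0..1}. k t = proj_point (cos (\<theta>' t)) (sin (\<theta>' t))) \<and>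
      \<bar>\<theta> 1 - \<theta> 0\<bar> / (2 * pi) = \<bar>\<theta>' 1 - \<theta>' 0\<bar> / (2 * pi)"
    using assms by blast
next
  fix r
  assume "\<exists>\<theta>'. continuous_on {0..1} \<theta>' \<and>
      (\<forall>t\<in>{0..1}. k t = proj_point (cos (\<theta>' t)) (sin (\<theta>' t))) \<and>
      r = \<bar>\<theta>' 1 - \<theta>' 0\<bar> / (2 * pi)"
  then obtain \<theta>' where \<theta>': "continuous_on {0..1} \<theta>'"
    "\<And>t. t \<in> {0..1} \<Longrightarrow> k t = proj_point (cos (\<theta>' t)) (sin (\<theta>' t))"
    "r = \<bar>\<theta>' 1 - \<theta>' 0\<bar> / (2 * pi)"
    by blast
  have "\<theta>' 0 - \<theta> 0 = \<theta>' 1 - \<theta> 1"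
  proof (rule sin_zero_constant[of "{0..1}" "\<lambda>t. \<theta>' t - \<theta> t"])
    show "continuous_on {0..1} (\<lambda>t. \<theta>' t - \<theta> t)"
      by (intro continuous_intros cont \<theta>')
    show "sin (\<theta>' t - \<theta> t) = 0" if "t \<in> {0..1}" for t
      using \<theta>'(2)[OF that] lift[OF that] by (intro proj_point_angle_eq_imp) simp
  qed auto
  then show "r = \<bar>\<theta> 1 - \<theta> 0\<bar> / (2 * pi)"
    using \<theta>'(3) by (simp add: algebra_simps)
qed

section \<open>Counting turns at the vertical axis\<close>

text \<open>The plane loop \<open>(A, K)\<close> crosses the vertical axis where \<open>A\<close> vanishes. The function \<open>A'\<close> is
  constrained at these zeros only, where it is the nonzero derivative of \<open>A\<close>.\<close>

locale transverse_loop =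
  fixes A K A' :: "real \<Rightarrow> real"
  assumes continuous_A: "continuous_on UNIV A"
    and continuous_K: "continuous_on UNIV K"
    and periodic_A: "periodic1 A"
    and periodic_K: "periodic1 K"
    and nonvanishing: "A t \<noteq> 0 \<or> K t \<noteq> 0"
    and deriv_at_zero: "A t = 0 \<Longrightarrow> (A has_real_derivative A' t) (at t)"
    and simple_zero: "A t = 0 \<Longrightarrow> A' t \<noteq> 0"
begin

definition crossing_letter :: "real \<Rightarrow> letter" where
  "crossing_letter t = (if K t > 0 then La else Lb)"

text \<open>Simple zeros are isolated, and they cannot accumulate elsewhere in a compact interval because
  \<open>A\<close> is continuous.\<close>

lemma finite_zeros: "finite {t \<in> {0..<1}. A t = 0}"
proof -
  have "\<not> z islimpt {t. A t = 0}" if "z \<in> {0..1}" for z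
  proof (cases "A z = 0")
    case True
    have "((\<lambda>y. (A y - A z) / (y - z)) \<longlongrightarrow> A' z) (at z)"
      using deriv_at_zero[OF True] by (simp add: has_field_derivative_iff)
    from tendsto_imp_eventually_ne[OF this simple_zero[OF True]]
    have "eventually (\<lambda>y. y \<notin> {t. A t = 0}) (at z)"
      by eventually_elim (use True in auto)
    then show ?thesis by (simp add: islimpt_iff_eventually)
  next
    case False
    have "(A \<longlongrightarrow> A z) (at z)"
      using continuous_A by (simp add: continuous_on_def)
    from tendsto_imp_eventually_ne[OF this False]
    show ?thesis by (simp add: islimpt_iff_eventually)
  qed
  then have "finite ({0..1} \<inter> {t. A t = 0})"
    by (intro finite_not_islimpt_in_compact) auto
  then show ?thesis
    by (rule rev_finite_subset) auto
qed

text \<open>\<open>A\<close> leaves the zero \<open>a\<close> with the sign of \<open>A' a\<close>, keeps this sign up to the next zero \<open>b\<close>, and has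
  to reach \<open>0\<close> there with nonzero slope, which therefore has the opposite sign.\<close>

lemma sign_between_zeros:
  assumes "a < b" and a: "A a = 0" and b: "A b = 0"
    and free: "\<And>t. a < t \<Longrightarrow> t < b \<Longrightarrow> A t \<noteq> 0"
  shows "\<And>t. a < t \<Longrightarrow> t < b \<Longrightarrow> 0 < sgn (A' a) * A t"
    and "sgn (A' b) = - sgn (A' a)"
proof -
  define B where "B t = sgn (A' a) * A t" for t
  have s: "sgn (A' a) \<noteq> 0" using simple_zero[OF a] by (simp add: sgn_0_0)
  have contB: "continuous_on S B" for S
    unfolding B_def by (intro continuous_intros continuous_on_subset[OF continuous_A]) auto
  have "(B has_real_derivative sgn (A' a) * A' a) (at a)"
    unfolding B_def by (intro DERIV_cmult deriv_at_zero a)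
  moreover have "sgn (A' a) * A' a > 0"
    using simple_zero[OF a] by (simp add: sgn_if)
  ultimately obtain d where d: "d > 0" "\<And>h. 0 < h \<Longrightarrow> h < d \<Longrightarrow> B a < B (a + h)"
    using DERIV_pos_inc_right by blast
  \<comment> \<open>a point close enough to \<open>a\<close> for the sign of the slope to decide the sign of \<open>B\<close>\<close>
  define c where "c = a + min (d / 2) ((b - a) / 2)"
  have c: "a < c" "c < b" "0 < B c"
    using d(2)[of "c - a"] d(1) \<open>a < b\<close> a by (auto simp: c_def B_def min_def field_simps)
  show pos: "0 < sgn (A' a) * A t" if t: "a < t" "t < b" for t
  proof (rule ccontr)
    assume "\<not> 0 < sgn (A' a) * A t"
    then have "B t \<le> 0" by (simp add: B_def)
    then have "\<exists>x. min c t \<le> x \<and> x \<le> max c t \<and> B x = 0"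
    proof (cases "c \<le> t")
      case True
      then show ?thesis using IVT2'[of B t 0 c] c \<open>B t \<le> 0\<close> contB by force
    next
      case False
      then show ?thesis using IVT'[of B t 0 c] c \<open>B t \<le> 0\<close> contB by force
    qed
    then obtain x where "a < x" "x < b" "B x = 0"
      using c t by (metis min_less_iff_conj max_less_iff_conj le_less_trans less_le_trans
          min_def max_def)
    then show False using free[of x] s by (simp add: B_def)
  qed
  have "\<not> 0 < sgn (A' a) * A' b"
  proof
    assume p: "0 < sgn (A' a) * A' b"
    have "(B has_real_derivative sgn (A' a) * A' b) (at b)"
      unfolding B_def by (intro DERIV_cmult deriv_at_zero b)
    from DERIV_pos_inc_left[OF this p]
    obtain d where d: "d > 0" "\<And>h. 0 < h \<Longrightarrow> h < d \<Longrightarrow> B (b - h) < B b" by blast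
    define h where "h = min (d / 2) ((b - a) / 2)"
    have "0 < h" "h < d" "a < b - h"
      using d(1) \<open>a < b\<close> by (auto simp: h_def min_def field_simps)
    with d(2)[of h] pos[of "b - h"] b show False by (simp add: B_def)
  qed
  with simple_zero[OF a] simple_zero[OF b] show "sgn (A' b) = - sgn (A' a)"
    by (auto simp: sgn_if split: if_splits)
qed

lemma angle_lift:
  obtains \<theta> :: "real \<Rightarrow> real" and r :: "real \<Rightarrow> real"
  where "continuous_on UNIV \<theta>" "\<And>t. r t > 0"
    "\<And>t. A t = r t * cos (\<theta> t)" "\<And>t. K t = r t * sin (\<theta> t)"
proof -
  have "continuous_on UNIV (\<lambda>t. Complex (A t) (K t))"
    unfolding Complex_eq by (intro continuous_intros continuous_A continuous_K)
  moreover have "contractible (UNIV :: real set)"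
    by (intro convex_imp_contractible) simp
  moreover have "Complex (A t) (K t) \<noteq> 0" for t
    using nonvanishing[of t] by (auto simp: complex_eq_iff)
  ultimately obtain g where g: "continuous_on UNIV g" "\<And>t. Complex (A t) (K t) = exp (g t)"
    using continuous_logarithm_on_contractible[of UNIV "\<lambda>t. Complex (A t) (K t)"] by auto
  show ?thesis
  proof (rule that[of "\<lambda>t. Im (g t)" "\<lambda>t. exp (Re (g t))"])
    show "A t = exp (Re (g t)) * cos (Im (g t))" for t
      using arg_cong[OF g(2), of Re t] by (simp add: Re_exp)
    show "K t = exp (Re (g t)) * sin (Im (g t))" for t
      using arg_cong[OF g(2), of Im t] by (simp add: Im_exp)
  qed (auto intro!: continuous_intros g)
qed

end

text \<open>A loop together with polar coordinates, which exist by the previous lemma; the angle is defined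
  on all of \<open>\<real>\<close> and need not be periodic.\<close>

locale lifted_transverse_loop = transverse_loop +
  fixes \<theta> r :: "real \<Rightarrow> real"
  assumes continuous_\<theta>: "continuous_on UNIV \<theta>"
    and r_pos: "r t > 0"
    and A_polar: "A t = r t * cos (\<theta> t)"
    and K_polar: "K t = r t * sin (\<theta> t)"
begin

lemma A_sign: "A t = 0 \<longleftrightarrow> cos (\<theta> t) = 0" "0 \<le> s * A t \<longleftrightarrow> 0 \<le> s * cos (\<theta> t)"
proof -
  show "A t = 0 \<longleftrightarrow> cos (\<theta> t) = 0"
    using r_pos[of t] by (simp add: A_polar)
  have scaled: "s * A t = r t * (s * cos (\<theta> t))"
    by (simp add: A_polar)
  show "0 \<le> s * A t \<longleftrightarrow> 0 \<le> s * cos (\<theta> t)"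
    unfolding scaled zero_le_mult_iff[of "r t"] using r_pos[of t] by auto
qed

lemma sin_at_zero:
  assumes "A t = 0"
  shows "sin (\<theta> t) = letter_sign (crossing_letter t)"
proof -
  have "(sin (\<theta> t))\<^sup>2 = 1"
    using assms A_sign(1) sin_cos_squared_add[of "\<theta> t"] by simp
  then have "sin (\<theta> t) = 1 \<or> sin (\<theta> t) = -1"
    by (simp add: power2_eq_1_iff)
  then show ?thesis
    using r_pos[of t] by (auto simp: crossing_letter_def K_polar)
qed

text \<open>On the right half plane an angle \<open>\<theta>\<close> equals \<open>arcsin (sin \<theta>)\<close> up to a multiple of \<open>2 * pi\<close>, and on
  the left half plane it equals \<open>pi - arcsin (sin \<theta>)\<close> up to such a multiple. In both cases the
  multiple is constant by continuity, so the turn is read off from the sines at the endpoints.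
  The sign \<open>s\<close> selects the half plane.\<close>

lemma turn_on_half_plane:
  assumes "a \<le> b" "\<bar>s\<bar> = 1" and half: "\<And>t. a \<le> t \<Longrightarrow> t \<le> b \<Longrightarrow> 0 \<le> s * A t"
  shows "\<theta> b - \<theta> a = s * (arcsin (sin (\<theta> b)) - arcsin (sin (\<theta> a)))"
proof -
  have "\<theta> a - s * arcsin (sin (\<theta> a)) = \<theta> b - s * arcsin (sin (\<theta> b))"
  proof (rule sin_zero_constant[of "{a..b}" "\<lambda>t. \<theta> t - s * arcsin (sin (\<theta> t))"])
    show "continuous_on {a..b} (\<lambda>t. \<theta> t - s * arcsin (sin (\<theta> t)))"
      by (intro continuous_intros continuous_on_subset[OF continuous_\<theta>]) auto
    fix t assume "t \<in> {a..b}"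
    then have *: "0 \<le> s * cos (\<theta> t)" using half A_sign by auto
    have "cos (arcsin (sin (\<theta> t))) = \<bar>cos (\<theta> t)\<bar>"
      by (simp add: cos_arcsin cos_squared_eq[symmetric])
    moreover have "s = 1 \<or> s = -1" using \<open>\<bar>s\<bar> = 1\<close> by auto
    ultimately show "sin (\<theta> t - s * arcsin (sin (\<theta> t))) = 0"
      using * by (auto simp: sin_diff sin_add)
  qed (use assms in auto)
  then show ?thesis by (simp add: algebra_simps)
qed

text \<open>At a crossing \<open>arcsin (sin \<theta>)\<close> is \<open>pi / 2\<close> or \<open>- pi / 2\<close> according to the letter.\<close>

lemma turn_between_zeros:
  assumes "a < b" and a: "A a = 0" and b: "A b = 0"
    and free: "\<And>t. a < t \<Longrightarrow> t < b \<Longrightarrow> A t \<noteq> 0"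
  shows "\<theta> b - \<theta> a = pi / 2 * sgn (A' a) *
    (letter_sign (crossing_letter b) - letter_sign (crossing_letter a))"
proof -
  have arcsin_sign: "arcsin (real_of_int (letter_sign x)) = letter_sign x * (pi / 2)" for x
    by (cases x) (simp_all add: arcsin_minus)
  have "0 \<le> sgn (A' a) * A t" if "a \<le> t" "t \<le> b" for t
    using sign_between_zeros(1)[OF assms, of t] a b that by (cases "t = a \<or> t = b") force+
  moreover have "\<bar>sgn (A' a)\<bar> = 1"
    using simple_zero[OF a] by (simp add: abs_sgn_eq)
  ultimately have "\<theta> b - \<theta> a = sgn (A' a) * (arcsin (sin (\<theta> b)) - arcsin (sin (\<theta> a)))"
    using \<open>a < b\<close> by (intro turn_on_half_plane) auto
  then show ?thesis
    by (simp add: sin_at_zero a b arcsin_sign algebra_simps)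
qed

text \<open>Adding up the turns between consecutive zeros \<open>a = t\<^sub>1 < \<dots> < t\<^sub>m < b\<close> and summing by parts, each
  inner letter is counted twice because the sign of \<open>A'\<close> alternates. The two boundary terms cancel
  when \<open>b\<close> is \<open>a\<close> shifted by a period.\<close>

lemma turn_along_zeros:
  assumes "sorted_wrt (<) (a # ts)" "\<forall>t\<in>{a..<b}. A t = 0 \<longleftrightarrow> t \<in> set (a # ts)"
    and "set (a # ts) \<subseteq> {a..<b}" and b: "A b = 0"
  shows "sgn (A' b) = (-1) ^ length (a # ts) * sgn (A' a)"
    and "\<theta> b - \<theta> a = pi / 2 *
      (sgn (A' a) * letter_sign (crossing_letter a) - sgn (A' b) * letter_sign (crossing_letter b)
        - 2 * sgn (A' a) * alternating_sum (map crossing_letter (a # ts)))"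
  using assms(1-3)
proof (induction ts arbitrary: a)
  case Nil
  {
    case 1
    then have "a < b" "A a = 0" "\<And>t. a < t \<Longrightarrow> t < b \<Longrightarrow> A t \<noteq> 0" by auto
    from sign_between_zeros(2)[OF this(1,2) b this(3)] show ?case by simp
  next
    case 2
    then have ab: "a < b" "A a = 0" "\<And>t. a < t \<Longrightarrow> t < b \<Longrightarrow> A t \<noteq> 0" by auto
    from sign_between_zeros(2)[OF ab(1,2) b ab(3)] turn_between_zeros[OF ab(1,2) b ab(3)]
    show ?case by (simp add: algebra_simps)
  }
next
  case (Cons c ts)
  \<comment> \<open>\<open>c\<close> is the zero that follows \<open>a\<close>, and \<open>c # ts\<close> lists the zeros from \<open>c\<close> on.\<close>
  have step: "a < c \<and> A a = 0 \<and> A c = 0 \<and> (\<forall>t. a < t \<and> t < c \<longrightarrow> A t \<noteq> 0) \<and>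
      sorted_wrt (<) (c # ts) \<and> (\<forall>t\<in>{c..<b}. A t = 0 \<longleftrightarrow> t \<in> set (c # ts)) \<and>
      set (c # ts) \<subseteq> {c..<b}"
    if "sorted_wrt (<) (a # c # ts)"
      "\<forall>t\<in>{a..<b}. A t = 0 \<longleftrightarrow> t \<in> set (a # c # ts)"
      "set (a # c # ts) \<subseteq> {a..<b}" for a
  proof (intro conjI allI impI ballI)
    show "a < c" "sorted_wrt (<) (c # ts)" using that(1) by auto
    show "A a = 0" using that by auto
    show "A c = 0" using that(2,3) by auto
    show "A t \<noteq> 0" if "a < t \<and> t < c" for t
      using that \<open>sorted_wrt (<) (a # c # ts)\<close> \<open>set (a # c # ts) \<subseteq> {a..<b}\<close>
        \<open>\<forall>t\<in>{a..<b}. A t = 0 \<longleftrightarrow> t \<in> set (a # c # ts)\<close> by auto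
    show "A t = 0 \<longleftrightarrow> t \<in> set (c # ts)" if "t \<in> {c..<b}" for t
      using that \<open>sorted_wrt (<) (a # c # ts)\<close>
        \<open>\<forall>t\<in>{a..<b}. A t = 0 \<longleftrightarrow> t \<in> set (a # c # ts)\<close> by auto
    show "set (c # ts) \<subseteq> {c..<b}" using that(1,3) by fastforce
  qed
  {
    case 1
    note s = step[OF 1]
    have "sgn (A' c) = - sgn (A' a)" using s by (intro sign_between_zeros(2)) auto
    moreover have "sgn (A' b) = (-1) ^ length (c # ts) * sgn (A' c)"
      using s by (intro Cons.IH(1)) auto
    ultimately show ?case by simp
  next
    case 2
    note s = step[OF 2]
    have "sgn (A' c) = - sgn (A' a)" using s by (intro sign_between_zeros(2)) auto
    moreover have "\<theta> c - \<theta> a = pi / 2 * sgn (A' a) *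
        (letter_sign (crossing_letter c) - letter_sign (crossing_letter a))"
      using s by (intro turn_between_zeros) auto
    moreover have "\<theta> b - \<theta> c = pi / 2 *
        (sgn (A' c) * letter_sign (crossing_letter c) - sgn (A' b) * letter_sign (crossing_letter b)
          - 2 * sgn (A' c) * alternating_sum (map crossing_letter (c # ts)))"
      using s by (intro Cons.IH(2)) auto
    ultimately show ?case
      by (simp add: algebra_simps)
  }
qed

end

context transverse_loop
begin

definition crossing_word :: "letter list" where
  "crossing_word = map crossing_letter (sorted_list_of_set {t \<in> {0..<1}. A t = 0})"

text \<open>The turn over a period does not depend on where the period starts, so it may be computed from
  the first crossing \<open>a\<close> to its translate \<open>a + 1\<close>. Comparing the slopes of \<open>A\<close> at these two points
  shows that the number of crossings is even.\<close>

theorem rotation_number_crossing_word: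
  "even (length crossing_word)" (is ?even)
  "rotation_number (\<lambda>t. proj_point (A t) (K t)) = \<bar>alternating_sum crossing_word\<bar> / 2" (is ?rot)
proof -
  obtain \<theta> r where lift: "continuous_on UNIV \<theta>" "\<And>t. r t > 0"
    "\<And>t. A t = r t * cos (\<theta> t)" "\<And>t. K t = r t * sin (\<theta> t)"
    using angle_lift by blast
  interpret lifted_transverse_loop A K A' \<theta> r
    by unfold_locales (use lift in auto)
  have per: "A (t + 1) = A t" "K (t + 1) = K t" for t
    using periodic_A periodic_K by (simp_all add: periodic1_def)
  have trig_per: "cos (\<theta> (t + 1)) = cos (\<theta> t)" "sin (\<theta> (t + 1)) = sin (\<theta> t)" for t
  proof -
    have norm_r: "(A t)\<^sup>2 + (K t)\<^sup>2 = (r t)\<^sup>2" for t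
      by (simp add: A_polar K_polar power_mult_distrib flip: distrib_left)
    have "(r (t + 1))\<^sup>2 = (r t)\<^sup>2"
      using norm_r[of t] norm_r[of "t + 1"] per by simp
    then have "r (t + 1) = r t"
      using r_pos[of t] r_pos[of "t + 1"] by (simp add: power2_eq_iff_nonneg less_imp_le)
    then show "cos (\<theta> (t + 1)) = cos (\<theta> t)" "sin (\<theta> (t + 1)) = sin (\<theta> t)"
      using per[of t] r_pos[of t] by (simp_all add: A_polar K_polar)
  qed
  \<comment> \<open>\<open>\<theta> (t + 1) - \<theta> t\<close> is a multiple of \<open>2 * pi\<close> depending continuously on \<open>t\<close>\<close>
  have turn_indep: "\<theta> (a + 1) - \<theta> a = \<theta> 1 - \<theta> 0" for a
  proof -
    have "\<theta> (a + 1) - \<theta> a = \<theta> (0 + 1) - \<theta> 0"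
    proof (rule sin_zero_constant[of UNIV "\<lambda>t. \<theta> (t + 1) - \<theta> t"])
      show "continuous_on UNIV (\<lambda>t. \<theta> (t + 1) - \<theta> t)"
        by (intro continuous_intros continuous_on_compose2[OF continuous_\<theta>] continuous_\<theta>) auto
    qed (auto simp: sin_diff trig_per)
    then show ?thesis by simp
  qed
  have rot: "rotation_number (\<lambda>t. proj_point (A t) (K t)) = \<bar>\<theta> 1 - \<theta> 0\<bar> / (2 * pi)"
  proof (rule rotation_number_eqI)
    show "continuous_on {0..1} \<theta>"
      by (rule continuous_on_subset[OF continuous_\<theta>]) simp
    show "proj_point (A t) (K t) = proj_point (cos (\<theta> t)) (sin (\<theta> t))" for t
      unfolding A_polar K_polar using r_pos[of t] by (intro proj_point_scale) simp
  qed
  define ts where "ts = sorted_list_of_set {t \<in> {0..<1}. A t = 0}"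
  have set_ts: "set ts = {t \<in> {0..<1}. A t = 0}"
    unfolding ts_def using finite_zeros by simp
  have word: "crossing_word = map crossing_letter ts"
    by (simp add: crossing_word_def ts_def)
  have "?even \<and> ?rot"
  proof (cases ts)
    \<comment> \<open>Without crossings the loop stays in an open half plane, and its net turn is zero.\<close>
    case Nil
    have free: "A t \<noteq> 0" if "0 \<le> t" "t \<le> 1" for t
      using set_ts Nil that per(1)[of 0] by (cases "t = 1") auto
    define s where "s = sgn (A 0)"
    have "0 \<le> s * A t" if t: "0 \<le> t" "t \<le> 1" for t
    proof (rule ccontr)
      assume neg: "\<not> 0 \<le> s * A t"
      have "\<exists>x. 0 \<le> x \<and> x \<le> t \<and> s * A x = 0"
      proof (rule IVT2'[of "\<lambda>x. s * A x" t 0 0])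
        show "continuous_on {0..t} (\<lambda>x. s * A x)"
          by (intro continuous_intros continuous_on_subset[OF continuous_A]) auto
        show "0 \<le> s * A 0" by (simp add: s_def sgn_if)
      qed (use neg t in auto)
      then obtain x where "0 \<le> x" "x \<le> t" "s * A x = 0" by blast
      then show False
        using free[of x] free[of 0] t by (simp add: s_def sgn_0_0)
    qed
    moreover have "\<bar>s\<bar> = 1" using free[of 0] by (simp add: s_def abs_sgn_eq)
    ultimately have "\<theta> 1 - \<theta> 0 = s * (arcsin (sin (\<theta> 1)) - arcsin (sin (\<theta> 0)))"
      by (intro turn_on_half_plane) auto
    also have "\<dots> = 0" using trig_per(2)[of 0] by simp
    finally show ?thesis using rot word Nil by simp
  next
    case (Cons a rest)
    have a: "a \<in> {0..<1}" "A a = 0" using set_ts Cons by auto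
    have sorted: "sorted_wrt (<) (a # rest)"
      using Cons unfolding ts_def by (metis sorted_list_of_set.strict_sorted_key_list_of_set)
    then have first: "a \<le> t" if "t \<in> {0..<1}" "A t = 0" for t
      using that set_ts Cons by force
    have zeros: "\<forall>t\<in>{a..<a + 1}. A t = 0 \<longleftrightarrow> t \<in> set (a # rest)"
    proof
      fix t assume t: "t \<in> {a..<a + 1}"
      show "A t = 0 \<longleftrightarrow> t \<in> set (a # rest)"
      proof (cases "t < 1")
        case True
        then show ?thesis using t a set_ts Cons by auto
      next
        case False
        then have "A t \<noteq> 0" using first[of "t - 1"] per(1)[of "t - 1"] t a by auto
        then show ?thesis using set_ts Cons by auto
      qed
    qed
    have range: "set (a # rest) \<subseteq> {a..<a + 1}"
    proof
      fix t assume "t \<in> set (a # rest)"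
      then have "t \<in> {0..<1}" "A t = 0" using set_ts Cons by auto
      then show "t \<in> {a..<a + 1}" using first a by force
    qed
    have a1: "A (a + 1) = 0" using a per by simp
    have "(A has_real_derivative A' (a + 1)) (at a)"
      using deriv_at_zero[OF a1] DERIV_shift[of A "A' (a + 1)" a 1] per by (simp add: add.commute)
    then have A'_per: "A' (a + 1) = A' a"
      using deriv_at_zero[OF a(2)] DERIV_unique by blast
    have "sgn (A' a) = (-1) ^ length (a # rest) * sgn (A' a)"
      using turn_along_zeros(1)[OF sorted zeros range a1] A'_per by simp
    then have even: "even (length (a # rest))"
      using simple_zero[OF a(2)] by (cases "even (length (a # rest))") (auto simp: sgn_0_0)
    have "crossing_letter (a + 1) = crossing_letter a"
      by (simp add: crossing_letter_def per)
    then have "\<theta> (a + 1) - \<theta> a = - pi * sgn (A' a) * alternating_sum crossing_word"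
      using turn_along_zeros(2)[OF sorted zeros range a1] A'_per word Cons by simp
    then have "\<bar>\<theta> 1 - \<theta> 0\<bar> = pi * \<bar>alternating_sum crossing_word\<bar>"
      using simple_zero[OF a(2)] turn_indep[of a] by (simp add: abs_mult abs_sgn_eq)
    then have ?rot using rot by simp
    with even word Cons show ?thesis by simp
  qed
  then show ?even ?rot by auto
qed

end

section \<open>Symplectic planes\<close>

locale symplectic_plane =
  fixes \<omega> :: "'a::real_normed_vector \<Rightarrow> 'a \<Rightarrow> real"
  assumes plane: "normed_plane TYPE('a)"
    and symplectic: "symplectic_form \<omega>"
begin

lemma bilinear_\<omega>: "bilinear \<omega>"
  using symplectic by (simp add: symplectic_form_def)

lemma \<omega>_self [simp]: "\<omega> v v = 0"
  using symplectic by (simp add: symplectic_form_def)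

lemmas \<omega>_expand = bilinear_ladd[OF bilinear_\<omega>] bilinear_radd[OF bilinear_\<omega>]
  bilinear_lmul[OF bilinear_\<omega>] bilinear_rmul[OF bilinear_\<omega>]

lemma \<omega>_swap: "\<omega> w v = - \<omega> v w"
  using \<omega>_self[of "v + w"] unfolding \<omega>_expand by simp

lemma coordinates:
  obtains e1 e2 :: 'a where "\<And>v. \<exists>x y. v = x *\<^sub>R e1 + y *\<^sub>R e2" "\<omega> e1 e2 \<noteq> 0"
proof -
  obtain B :: "'a set" where B: "independent B" "UNIV \<subseteq> span B" "card B = dim (UNIV :: 'a set)"
    using basis_exists by blast
  then obtain e1 e2 where e: "B = {e1, e2}" "e1 \<noteq> e2"
    using plane by (auto simp: normed_plane_def card_2_iff)
  have coord: "\<exists>x y. v = x *\<^sub>R e1 + y *\<^sub>R e2" for v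
  proof -
    have "v \<in> span {e1, e2}" using B e by auto
    then obtain x where "v - x *\<^sub>R e1 \<in> span {e2}"
      by (auto simp: span_insert)
    then obtain y where "v - x *\<^sub>R e1 = y *\<^sub>R e2"
      by (auto simp: span_singleton)
    then have "v = x *\<^sub>R e1 + y *\<^sub>R e2" by (simp add: algebra_simps)
    then show ?thesis by blast
  qed
  have "\<omega> e1 e2 \<noteq> 0"
  proof
    assume "\<omega> e1 e2 = 0"
    then have "\<omega> e1 v = 0" for v
      using coord[of v] by (auto simp: \<omega>_expand)
    then have "e1 = 0"
      using symplectic by (simp add: symplectic_form_def)
    then show False
      using B(1) e dependent_zero by auto
  qed
  with coord show ?thesis using that by blast
qed

text \<open>Cramer's rule in symmetric form: three vectors of a plane are linearly dependent, with their
  pairwise values of \<open>\<omega>\<close> as coefficients.\<close>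

lemma cramer: "\<omega> v w *\<^sub>R u + \<omega> w u *\<^sub>R v + \<omega> u v *\<^sub>R w = 0"
proof -
  obtain e1 e2 where e: "\<And>v. \<exists>x y. v = x *\<^sub>R e1 + y *\<^sub>R e2" "\<omega> e1 e2 \<noteq> 0"
    using coordinates by blast
  obtain x1 y1 where u: "u = x1 *\<^sub>R e1 + y1 *\<^sub>R e2" using e(1) by blast
  obtain x2 y2 where v: "v = x2 *\<^sub>R e1 + y2 *\<^sub>R e2" using e(1) by blast
  obtain x3 y3 where w: "w = x3 *\<^sub>R e1 + y3 *\<^sub>R e2" using e(1) by blast
  have "p *\<^sub>R u + q *\<^sub>R v + r *\<^sub>R w =
    (p * x1 + q * x2 + r * x3) *\<^sub>R e1 + (p * y1 + q * y2 + r * y3) *\<^sub>R e2" for p q r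
    unfolding u v w by (simp add: algebra_simps)
  moreover have "\<omega> v w * x1 + \<omega> w u * x2 + \<omega> u v * x3 = 0"
    "\<omega> v w * y1 + \<omega> w u * y2 + \<omega> u v * y3 = 0"
    unfolding u v w by (simp_all add: \<omega>_expand \<omega>_swap[of e2 e1] algebra_simps)
  ultimately show ?thesis by simp
qed

lemma decompose:
  assumes "\<omega> u v \<noteq> 0"
  obtains a b where "w = a *\<^sub>R u + b *\<^sub>R v"
proof -
  have "\<omega> u v *\<^sub>R w = \<omega> w v *\<^sub>R u + \<omega> u w *\<^sub>R v"
    using cramer[of v w u] \<omega>_swap[of v w] \<omega>_swap[of w u] by (simp add: algebra_simps)
  then have "w = (1 / \<omega> u v) *\<^sub>R (\<omega> w v *\<^sub>R u + \<omega> u w *\<^sub>R v)"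
    using assms by (metis divide_inverse mult_1 real_vector.scale_one scaleR_scaleR left_inverse)
  then have "w = (\<omega> w v / \<omega> u v) *\<^sub>R u + (\<omega> u w / \<omega> u v) *\<^sub>R v"
    by (simp add: scaleR_add_right)
  then show ?thesis by (rule that)
qed

lemma \<omega>_zero_imp_parallel:
  assumes "u \<noteq> 0" "\<omega> u v = 0"
  obtains c where "v = c *\<^sub>R u"
proof -
  obtain w where w: "\<omega> u w \<noteq> 0"
    using assms(1) symplectic by (auto simp: symplectic_form_def)
  obtain a b where v: "v = a *\<^sub>R u + b *\<^sub>R w"
    using decompose[OF w] by blast
  then have "b = 0" using assms(2) w by (simp add: \<omega>_expand)
  with v show ?thesis using that[of a] by simp
qed

text \<open>This is the equivalence of norms in finite dimension. The coordinates of a vector are bounded by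
  its norm, because the norm has a positive minimum \<open>m\<close> on the Euclidean unit circle of the
  coordinate plane; and \<open>\<omega>\<close> is a multiple of the determinant in coordinates.\<close>

lemma bounded_bilinear_\<omega>: "bounded_bilinear \<omega>"
proof -
  obtain e1 e2 where e: "\<And>v. \<exists>x y. v = x *\<^sub>R e1 + y *\<^sub>R e2" "\<omega> e1 e2 \<noteq> 0"
    using coordinates by blast
  define \<phi> where "\<phi> p = fst p *\<^sub>R e1 + snd p *\<^sub>R e2" for p :: "real \<times> real"
  have \<phi>_nz: "\<phi> p \<noteq> 0" if "p \<noteq> 0" for p
  proof
    assume "\<phi> p = 0"
    moreover have "\<omega> (\<phi> p) e2 = fst p * \<omega> e1 e2" "\<omega> e1 (\<phi> p) = snd p * \<omega> e1 e2"
      by (simp_all add: \<phi>_def \<omega>_expand)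
    ultimately show False
      using that e(2) bilinear_lzero[OF bilinear_\<omega>] bilinear_rzero[OF bilinear_\<omega>]
      by (auto simp: prod_eq_iff)
  qed
  have "compact (sphere (0 :: real \<times> real) 1)" by simp
  moreover have "(1, 0) \<in> sphere (0 :: real \<times> real) 1" by (simp add: norm_Pair)
  moreover have "continuous_on (sphere 0 1) (\<lambda>p. norm (\<phi> p))"
    unfolding \<phi>_def by (intro continuous_intros)
  ultimately obtain q where q: "q \<in> sphere 0 1"
    "\<And>p. p \<in> sphere 0 1 \<Longrightarrow> norm (\<phi> q) \<le> norm (\<phi> p)"
    using continuous_attains_inf[of "sphere (0 :: real \<times> real) 1" "\<lambda>p. norm (\<phi> p)"] by blast
  define m where "m = norm (\<phi> q)"
  have "q \<noteq> 0" using q(1) by auto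
  then have m: "m > 0" using \<phi>_nz by (simp add: m_def)
  have lower: "m * norm p \<le> norm (\<phi> p)" for p
  proof (cases "p = 0")
    case False
    have "\<phi> (p /\<^sub>R norm p) = \<phi> p /\<^sub>R norm p"
      by (simp add: \<phi>_def scaleR_add_right)
    moreover have "p /\<^sub>R norm p \<in> sphere 0 1" using False by simp
    ultimately have "m \<le> norm (\<phi> p) / norm p"
      using q(2)[of "p /\<^sub>R norm p"] by (simp add: m_def divide_inverse mult.commute)
    then show ?thesis using False by (simp add: field_simps)
  qed simp
  have component: "\<bar>fst p\<bar> \<le> norm (\<phi> p) / m" "\<bar>snd p\<bar> \<le> norm (\<phi> p) / m" for p
  proof -
    have "norm p \<le> norm (\<phi> p) / m"
      using lower[of p] m by (simp add: pos_le_divide_eq mult.commute)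
    then show "\<bar>fst p\<bar> \<le> norm (\<phi> p) / m" "\<bar>snd p\<bar> \<le> norm (\<phi> p) / m"
      using norm_fst_le[of "fst p" "snd p"] norm_snd_le[of "snd p" "fst p"] by simp_all
  qed
  have "norm (\<omega> v w) \<le> norm v * norm w * (2 * \<bar>\<omega> e1 e2\<bar> / m\<^sup>2)" for v w
  proof -
    obtain x y where v: "v = \<phi> (x, y)" using e(1)[of v] by (auto simp: \<phi>_def)
    obtain x' y' where w: "w = \<phi> (x', y')" using e(1)[of w] by (auto simp: \<phi>_def)
    have fst_snd: "\<bar>x\<bar> \<le> norm v / m" "\<bar>y\<bar> \<le> norm v / m" "\<bar>x'\<bar> \<le> norm w / m" "\<bar>y'\<bar> \<le> norm w / m"
      using component[of "(x, y)"] component[of "(x', y')"] by (simp_all add: v w)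
    have "\<omega> v w = (x * y' - y * x') * \<omega> e1 e2"
      by (simp add: v w \<phi>_def \<omega>_expand \<omega>_swap[of e2 e1] algebra_simps)
    then have "norm (\<omega> v w) = \<bar>x * y' - y * x'\<bar> * \<bar>\<omega> e1 e2\<bar>"
      by (simp add: abs_mult)
    also have "\<dots> \<le> (\<bar>x\<bar> * \<bar>y'\<bar> + \<bar>y\<bar> * \<bar>x'\<bar>) * \<bar>\<omega> e1 e2\<bar>"
      by (intro mult_right_mono) (auto simp flip: abs_mult)
    also have "\<dots> \<le> (norm v / m * (norm w / m) + norm v / m * (norm w / m)) * \<bar>\<omega> e1 e2\<bar>"
      using m by (intro mult_right_mono add_mono mult_mono fst_snd) auto
    also have "\<dots> = norm v * norm w * (2 * \<bar>\<omega> e1 e2\<bar> / m\<^sup>2)"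
      by (simp add: power2_eq_square)
    finally show ?thesis .
  qed
  then have "\<exists>C. \<forall>v w. norm (\<omega> v w) \<le> norm v * norm w * C"
    by blast
  then show ?thesis
    by unfold_locales (simp_all add: \<omega>_expand)
qed

end

section \<open>Birkhoff orthogonality on the unit circle\<close>

lemma birkhoff_orth_scaleR_imp_zero:
  assumes "birkhoff_orth x (c *\<^sub>R x)" "x \<noteq> 0"
  shows "c = 0"
proof (rule ccontr)
  assume "c \<noteq> 0"
  then show False
    using assms unfolding birkhoff_orth_def by (auto dest!: spec[of _ "- 1 / c"])
qed

lemma birkhoff_orth_scaleR:
  assumes "birkhoff_orth x y"
  shows "birkhoff_orth x (c *\<^sub>R y)"
  using assms unfolding birkhoff_orth_def by simp

lemma birkhoff_orth_tendsto:
  assumes "\<And>n. birkhoff_orth (f n) (g n)" "(f \<longlongrightarrow> x) F" "(g \<longlongrightarrow> y) F" "F \<noteq> bot"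
  shows "birkhoff_orth x y"
  unfolding birkhoff_orth_def
proof
  fix t :: real
  have "((\<lambda>n. norm (f n + t *\<^sub>R g n)) \<longlongrightarrow> norm (x + t *\<^sub>R y)) F"
    by (intro tendsto_intros assms)
  moreover have "((\<lambda>n. norm (f n)) \<longlongrightarrow> norm x) F"
    by (intro tendsto_intros assms)
  ultimately show "norm x \<le> norm (x + t *\<^sub>R y)"
    by (rule tendsto_le[OF assms(4)]) (use assms(1) in \<open>simp add: birkhoff_orth_def\<close>)
qed

text \<open>The curve has norm 1 and differs from its tangent line by \<open>o(s)\<close>. So the norm restricted to the
  tangent line has derivative 0 at the point of contact.\<close>

lemma unit_curve_first_order:
  fixes \<sigma> :: "real \<Rightarrow> 'a::real_normed_vector"
  assumes unit: "\<And>t. norm (\<sigma> t) = 1" and deriv: "(\<sigma> has_vector_derivative v) (at t)" and "e > 0"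
  obtains d where "d > 0" "\<And>s. \<bar>s\<bar> < d \<Longrightarrow> \<bar>norm (\<sigma> t + s *\<^sub>R v) - 1\<bar> \<le> e * \<bar>s\<bar>"
proof -
  obtain d where d: "d > 0"
    "\<And>y. norm (y - t) < d \<Longrightarrow> norm (\<sigma> y - \<sigma> t - (y - t) *\<^sub>R v) \<le> e * norm (y - t)"
    using deriv \<open>e > 0\<close> unfolding has_vector_derivative_def has_derivative_at_alt by blast
  have "\<bar>norm (\<sigma> t + s *\<^sub>R v) - 1\<bar> \<le> e * \<bar>s\<bar>" if "\<bar>s\<bar> < d" for s
  proof -
    have "\<bar>norm (\<sigma> t + s *\<^sub>R v) - norm (\<sigma> (t + s))\<bar> \<le> norm (\<sigma> (t + s) - \<sigma> t - s *\<^sub>R v)"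
      using norm_triangle_ineq3[of "\<sigma> (t + s)" "\<sigma> t + s *\<^sub>R v"]
      by (simp add: abs_minus_commute diff_diff_eq)
    also have "\<dots> \<le> e * \<bar>s\<bar>" using d(2)[of "t + s"] that by simp
    finally show ?thesis by (simp add: unit)
  qed
  with d(1) show ?thesis by (rule that)
qed

text \<open>If the tangent line entered the open unit ball, convexity of the norm would make the norm decrease
  linearly along it from the point of contact, against the first-order estimate.\<close>

lemma birkhoff_orth_tangent:
  fixes \<sigma> :: "real \<Rightarrow> 'a::real_normed_vector"
  assumes unit: "\<And>t. norm (\<sigma> t) = 1" and deriv: "(\<sigma> has_vector_derivative v) (at t)"
  shows "birkhoff_orth (\<sigma> t) v"
  unfolding birkhoff_orth_def
proof (rule allI, rule ccontr)
  fix s :: real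
  define q where "q = norm (\<sigma> t + s *\<^sub>R v)"
  assume "\<not> norm (\<sigma> t) \<le> norm (\<sigma> t + s *\<^sub>R v)"
  then have q: "q < 1" by (simp add: q_def unit)
  then have s: "s \<noteq> 0" by (auto simp: q_def unit)
  \<comment> \<open>By convexity the norm loses at least \<open>h * (1 - q)\<close> at parameter \<open>h * s\<close>; this \<open>e\<close> allows half of that.\<close>
  define e where "e = (1 - q) / (2 * \<bar>s\<bar>)"
  have "e > 0" using q s by (simp add: e_def)
  then obtain d where d: "d > 0" "\<And>r. \<bar>r\<bar> < d \<Longrightarrow> \<bar>norm (\<sigma> t + r *\<^sub>R v) - 1\<bar> \<le> e * \<bar>r\<bar>"
    using unit_curve_first_order[OF unit deriv] by metis
  define h where "h = min 1 (d / (2 * \<bar>s\<bar>))"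
  have h: "0 < h" "h \<le> 1" "\<bar>h * s\<bar> < d"
  proof -
    show "0 < h" "h \<le> 1" using d s by (auto simp: h_def)
    have "h * \<bar>s\<bar> \<le> d / (2 * \<bar>s\<bar>) * \<bar>s\<bar>" by (intro mult_right_mono) (auto simp: h_def)
    also have "\<dots> < d" using s d by simp
    finally show "\<bar>h * s\<bar> < d" using \<open>0 < h\<close> by (simp add: abs_mult)
  qed
  have "\<sigma> t + (h * s) *\<^sub>R v = (1 - h) *\<^sub>R \<sigma> t + h *\<^sub>R (\<sigma> t + s *\<^sub>R v)"
    by (simp add: algebra_simps)
  then have "norm (\<sigma> t + (h * s) *\<^sub>R v) \<le> norm ((1 - h) *\<^sub>R \<sigma> t) + norm (h *\<^sub>R (\<sigma> t + s *\<^sub>R v))"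
    by (metis norm_triangle_ineq)
  also have "\<dots> = 1 - h * (1 - q)"
  proof -
    have "norm ((1 - h) *\<^sub>R \<sigma> t) = 1 - h" "norm (h *\<^sub>R (\<sigma> t + s *\<^sub>R v)) = h * q"
      using h by (simp_all only: norm_scaleR unit q_def) simp_all
    then show ?thesis by (simp add: algebra_simps)
  qed
  finally have "norm (\<sigma> t + (h * s) *\<^sub>R v) \<le> 1 - h * (1 - q)" .
  moreover have "\<bar>norm (\<sigma> t + (h * s) *\<^sub>R v) - 1\<bar> \<le> h * (1 - q) / 2"
  proof -
    have "e * \<bar>s\<bar> = (1 - q) / 2" using s by (simp add: e_def)
    then have "e * \<bar>h * s\<bar> = h * (1 - q) / 2" using h(1) by (simp add: abs_mult mult.left_commute)
    then show ?thesis using d(2)[OF h(3)] by simp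
  qed
  moreover have "h * (1 - q) > 0" using h q by simp
  ultimately show False by linarith
qed

text \<open>The converse: at a point of a regular unit curve the tangent direction is the only Birkhoff
  orthogonal one. Up to a term of size \<open>o(r)\<close> the norm of \<open>\<sigma> t + r *\<^sub>R (a *\<^sub>R \<sigma> t + b *\<^sub>R v)\<close> is
  \<open>1 + r * a\<close>, since the component along \<open>v\<close> has no first-order effect. If \<open>a \<noteq> 0\<close>, a small \<open>r\<close> of
  sign opposite to \<open>a\<close> makes this less than 1.\<close>

lemma birkhoff_orth_imp_tangent:
  fixes \<sigma> :: "real \<Rightarrow> 'a::real_normed_vector"
  assumes unit: "\<And>t. norm (\<sigma> t) = 1" and deriv: "(\<sigma> has_vector_derivative v) (at t)"
    and orth: "birkhoff_orth (\<sigma> t) (a *\<^sub>R \<sigma> t + b *\<^sub>R v)"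
  shows "a = 0"
proof (rule ccontr)
  assume a: "a \<noteq> 0"
  define e where "e = \<bar>a\<bar> / (2 * (\<bar>b\<bar> + 1))"
  have "e > 0" using a by (simp add: e_def add_nonneg_pos)
  then obtain d where d: "d > 0" "\<And>r. \<bar>r\<bar> < d \<Longrightarrow> \<bar>norm (\<sigma> t + r *\<^sub>R v) - 1\<bar> \<le> e * \<bar>r\<bar>"
    using unit_curve_first_order[OF unit deriv] by metis
  \<comment> \<open>The first bound keeps the factor \<open>l = 1 + r * a\<close> at least \<open>1 / 2\<close>; the second keeps \<open>u\<close>, the parameter
    on the tangent line after dividing by \<open>l\<close>, within the range \<open>d\<close> of the first-order estimate.\<close>
  define h where "h = min (1 / (2 * \<bar>a\<bar>)) (d / (2 * (\<bar>b\<bar> + 1)))"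
  have h: "0 < h" "h * \<bar>a\<bar> \<le> 1 / 2" "h * (\<bar>b\<bar> + 1) \<le> d / 2"
  proof -
    show "0 < h" using d a by (simp add: h_def add_nonneg_pos)
    have "h * \<bar>a\<bar> \<le> 1 / (2 * \<bar>a\<bar>) * \<bar>a\<bar>" by (intro mult_right_mono) (auto simp: h_def)
    then show "h * \<bar>a\<bar> \<le> 1 / 2" using a by simp
    have "h \<le> d / (2 * (\<bar>b\<bar> + 1))" by (simp add: h_def)
    then have "h * (2 * (\<bar>b\<bar> + 1)) \<le> d"
      by (subst (asm) pos_le_divide_eq) auto
    then show "h * (\<bar>b\<bar> + 1) \<le> d / 2" by (simp add: algebra_simps)
  qed
  define r where "r = - sgn a * h"
  define l where "l = 1 - h * \<bar>a\<bar>"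
  define u where "u = r * b / l"
  have l: "l \<ge> 1 / 2" "1 + r * a = l"
    using h by (auto simp: l_def r_def abs_sgn)
  have abs_r: "\<bar>r\<bar> = h" using a h by (simp add: r_def abs_mult abs_sgn_eq)
  have lu: "l * \<bar>u\<bar> = h * \<bar>b\<bar>" using l by (simp add: u_def abs_mult abs_r)
  have "\<bar>u\<bar> \<le> 2 * (h * \<bar>b\<bar>)"
  proof -
    have "1 / 2 * \<bar>u\<bar> \<le> l * \<bar>u\<bar>" using l by (intro mult_right_mono) auto
    then show ?thesis using lu by simp
  qed
  also have "\<dots> < 2 * (h * (\<bar>b\<bar> + 1))" using h by simp
  also have "\<dots> \<le> d" using h by simp
  finally have "\<bar>norm (\<sigma> t + u *\<^sub>R v) - 1\<bar> \<le> e * \<bar>u\<bar>" by (rule d(2))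
  then have "l * norm (\<sigma> t + u *\<^sub>R v) \<le> l * (1 + e * \<bar>u\<bar>)"
    using l by (intro mult_left_mono) auto
  also have "\<dots> = 1 - h * \<bar>a\<bar> + e * (h * \<bar>b\<bar>)"
    by (simp add: l_def[symmetric] lu[symmetric] algebra_simps)
  also have "\<dots> < 1"
  proof -
    have "e * \<bar>b\<bar> < e * (2 * (\<bar>b\<bar> + 1))" using \<open>e > 0\<close> by (intro mult_strict_left_mono) auto
    also have "\<dots> = \<bar>a\<bar>" by (simp add: e_def add_nonneg_pos less_imp_neq[symmetric])
    finally have "h * (e * \<bar>b\<bar>) < h * \<bar>a\<bar>" using h by simp
    then show ?thesis by (simp add: algebra_simps)
  qed
  finally have "l * norm (\<sigma> t + u *\<^sub>R v) < 1" .
  moreover have "\<sigma> t + r *\<^sub>R (a *\<^sub>R \<sigma> t + b *\<^sub>R v) = l *\<^sub>R (\<sigma> t + u *\<^sub>R v)"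
  proof -
    have "l * u = r * b" using l(1) by (simp add: u_def)
    moreover have "\<sigma> t + r *\<^sub>R (a *\<^sub>R \<sigma> t + b *\<^sub>R v) = (1 + r * a) *\<^sub>R \<sigma> t + (r * b) *\<^sub>R v"
      by (simp add: algebra_simps)
    ultimately show ?thesis by (simp add: l(2) scaleR_add_right)
  qed
  ultimately have "norm (\<sigma> t + r *\<^sub>R (a *\<^sub>R \<sigma> t + b *\<^sub>R v)) < 1"
    using l by simp
  then show False using orth unit unfolding birkhoff_orth_def by (metis not_le)
qed

context symplectic_plane
begin

text \<open>A nonzero vector is not Birkhoff orthogonal to any nonzero multiple of itself, and in the plane
  the vanishing of \<open>\<omega>\<close> means parallelism.\<close>

lemma \<omega>_birkhoff_nonzero:
  assumes "birkhoff_orth u v" "u \<noteq> 0" "v \<noteq> 0"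
  shows "\<omega> u v \<noteq> 0"
proof
  assume "\<omega> u v = 0"
  then obtain c where "v = c *\<^sub>R u" using \<omega>_zero_imp_parallel assms(2) by blast
  then show False using birkhoff_orth_scaleR_imp_zero[of u c] assms by auto
qed

text \<open>Smoothness of the unit circle gives a tangent \<open>\<tau>\<close> at \<open>v\<close>, and the vectors Birkhoff orthogonal to \<open>v\<close>
  are exactly its multiples. Hence the vector described by \<open>bvec\<close> exists, is unique, and spans this
  line.\<close>

lemma bvec_spans_birkhoff_orth:
  assumes smooth: "smooth_plane TYPE('a)" and v: "v \<in> sphere 0 1"
  shows "norm (bvec \<omega> v) = 1" "\<omega> v (bvec \<omega> v) > 0"
    "birkhoff_orth v w \<Longrightarrow> \<exists>c. w = c *\<^sub>R bvec \<omega> v"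
proof -
  obtain \<sigma> :: "real \<Rightarrow> 'a" where \<sigma>: "smooth_curve \<sigma>" "\<And>t. vderiv \<sigma> t \<noteq> 0" "range \<sigma> = sphere 0 1"
    using smooth unfolding smooth_plane_def by blast
  obtain t where t: "v = \<sigma> t" using v \<sigma>(3) by blast
  have unit: "norm (\<sigma> s) = 1" for s using \<sigma>(3) by (metis rangeI dist_0_norm mem_sphere)
  define \<tau> where "\<tau> = vderiv \<sigma> t"
  have "(\<sigma> has_vector_derivative \<tau>) (at t)"
    using \<sigma>(1)[unfolded smooth_curve_def, rule_format, of 0 t]
    by (simp add: \<tau>_def vderiv_def vector_derivative_works)
  note tangent = birkhoff_orth_tangent[OF unit this] birkhoff_orth_imp_tangent[OF unit this]
  have v0: "v \<noteq> 0" using v by auto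
  have nz: "\<omega> v \<tau> \<noteq> 0"
    using \<omega>_birkhoff_nonzero tangent(1) t v0 \<sigma>(2) \<tau>_def by simp
  define b where "b = (sgn (\<omega> v \<tau>) / norm \<tau>) *\<^sub>R \<tau>"
  have b: "norm b = 1" "birkhoff_orth v b" "\<omega> v b > 0"
  proof -
    have \<tau>: "norm \<tau> > 0" using \<sigma>(2) by (simp add: \<tau>_def)
    show "norm b = 1" using nz \<tau> by (simp add: b_def abs_sgn_eq)
    show "birkhoff_orth v b" unfolding b_def t by (intro birkhoff_orth_scaleR tangent)
    have "\<omega> v b = \<bar>\<omega> v \<tau>\<bar> / norm \<tau>" by (simp add: b_def \<omega>_expand abs_sgn)
    then show "\<omega> v b > 0" using nz \<tau> by simp
  qed
  have line: "\<exists>c. w = c *\<^sub>R b" if "birkhoff_orth v w" for w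
  proof -
    obtain a d where w: "w = a *\<^sub>R v + d *\<^sub>R \<tau>" using decompose[OF nz] by blast
    then have "a = 0" using tangent(2) that t by blast
    moreover have "\<tau> = (sgn (\<omega> v \<tau>) * norm \<tau>) *\<^sub>R b"
      using nz \<sigma>(2) by (simp add: b_def \<tau>_def sgn_if)
    ultimately have "w = (d * (sgn (\<omega> v \<tau>) * norm \<tau>)) *\<^sub>R b"
      using w by (metis add_0 scaleR_scaleR scaleR_zero_left)
    then show ?thesis by blast
  qed
  have "bvec \<omega> v = b"
    unfolding bvec_def
  proof (rule the_equality)
    show "b \<in> sphere 0 1 \<and> birkhoff_orth v b \<and> \<omega> v b > 0" using b by simp
    fix w assume w: "w \<in> sphere 0 1 \<and> birkhoff_orth v w \<and> \<omega> v w > 0"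
    then obtain c where c: "w = c *\<^sub>R b" using line by blast
    then have "\<bar>c\<bar> = 1" using w b by simp
    moreover have "c > 0" using w c b by (simp add: \<omega>_expand zero_less_mult_iff)
    ultimately show "w = b" using c by simp
  qed
  with b line show "norm (bvec \<omega> v) = 1" "\<omega> v (bvec \<omega> v) > 0"
    "birkhoff_orth v w \<Longrightarrow> \<exists>c. w = c *\<^sub>R bvec \<omega> v" by auto
qed

end

section \<open>Fronts\<close>

lemma smooth_curve_derivs:
  assumes "smooth_curve f"
  shows "(f has_vector_derivative vderiv f t) (at t)"
    "(vderiv f has_vector_derivative vderiv (vderiv f) t) (at t)"
  using assms[unfolded smooth_curve_def, rule_format, of 0 t]
    assms[unfolded smooth_curve_def, rule_format, of 1 t]
  by (simp_all add: vderiv_def vector_derivative_works)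

lemma has_vector_derivative_slope:
  assumes "(f has_vector_derivative v) (at t)"
  shows "((\<lambda>s. (f s - f t) /\<^sub>R (s - t)) \<longlongrightarrow> v) (at t)"
proof -
  have "((\<lambda>s. norm ((f s - f t - (s - t) *\<^sub>R v) /\<^sub>R \<bar>s - t\<bar>)) \<longlongrightarrow> 0) (at t)"
    using assms
    by (intro tendsto_norm_zero)
      (simp add: has_vector_derivative_def has_derivative_at_within diff_diff_eq)
  moreover have "eventually (\<lambda>s. norm ((f s - f t - (s - t) *\<^sub>R v) /\<^sub>R \<bar>s - t\<bar>) =
      norm ((f s - f t) /\<^sub>R (s - t) - v)) (at t)"
    unfolding eventually_at_filter
  proof (intro always_eventually allI impI)
    fix s assume "s \<noteq> t"
    then have "(f s - f t) /\<^sub>R (s - t) - v = (f s - f t - (s - t) *\<^sub>R v) /\<^sub>R (s - t)"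
      by (simp add: scaleR_diff_right)
    then show "norm ((f s - f t - (s - t) *\<^sub>R v) /\<^sub>R \<bar>s - t\<bar>) =
        norm ((f s - f t) /\<^sub>R (s - t) - v)"
      by simp
  qed
  ultimately have "((\<lambda>s. norm ((f s - f t) /\<^sub>R (s - t) - v)) \<longlongrightarrow> 0) (at t)"
    by (rule Lim_transform_eventually)
  then show ?thesis
    by (simp only: tendsto_norm_zero_iff LIM_zero_iff)
qed

lemma vderiv_periodic1:
  assumes "smooth_curve f" "periodic1 f"
  shows "periodic1 (vderiv f)"
  unfolding periodic1_def
proof
  fix t
  have "((\<lambda>s. s + 1) has_vector_derivative 1) (at t)"
    by (auto intro!: derivative_eq_intros)
  from vector_diff_chain_at[OF this smooth_curve_derivs(1)[OF assms(1)]]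
  have "((f \<circ> (\<lambda>s. s + 1)) has_vector_derivative 1 *\<^sub>R vderiv f (t + 1)) (at t)" .
  moreover have "f \<circ> (\<lambda>s. s + 1) = f"
    using assms(2) by (auto simp: periodic1_def)
  ultimately have "(f has_vector_derivative vderiv f (t + 1)) (at t)" by simp
  then show "vderiv f (t + 1) = vderiv f t"
    by (metis smooth_curve_derivs(1)[OF assms(1)] vector_derivative_at)
qed

theorem theorem4p1:
  fixes \<omega> :: "'a::real_normed_vector \<Rightarrow> 'a \<Rightarrow> real"
    and \<gamma> \<eta> :: "real \<Rightarrow> 'a"
  assumes "normed_plane TYPE('a)"
    and "smooth_plane TYPE('a)"
    and "strictly_convex_plane TYPE('a)"
    and "symplectic_form \<omega>"
    and "legendre_immersion \<gamma> \<eta>"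
    and "generic_front \<gamma> \<eta>"
  shows "real (zigzag_number \<omega> \<gamma> \<eta>) = rotation_number (k_map \<omega> \<gamma> \<eta>)"
proof -
  interpret symplectic_plane \<omega>
    using assms by unfold_locales
  interpret bb: bounded_bilinear \<omega>
    by (rule bounded_bilinear_\<omega>)
  have \<gamma>: "periodic1 \<gamma>" "smooth_curve \<gamma>" and \<eta>: "periodic1 \<eta>" "smooth_curve \<eta>"
    and unit: "\<And>t. \<eta> t \<in> sphere 0 1" and tangent_\<gamma>: "\<And>t. birkhoff_orth (\<eta> t) (vderiv \<gamma> t)"
    and immersion: "\<And>t. \<not> (vderiv \<gamma> t = 0 \<and> vderiv \<eta> t = 0)"
    using assms(5) by (auto simp: legendre_immersion_def)
  have \<eta>_nz: "\<eta> t \<noteq> 0" for t using unit[of t] by auto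
  have tangent_\<eta>: "birkhoff_orth (\<eta> t) (vderiv \<eta> t)" for t
    using unit by (intro birkhoff_orth_tangent smooth_curve_derivs \<eta>) (metis dist_0_norm mem_sphere)
  define A where "A t = \<omega> (\<eta> t) (vderiv \<gamma> t)" for t
  define K where "K t = \<omega> (\<eta> t) (vderiv \<eta> t)" for t
  define A' where "A' t = \<omega> (\<eta> t) (vderiv (vderiv \<gamma>) t) + \<omega> (vderiv \<eta> t) (vderiv \<gamma> t)" for t
  have A_zero: "A t = 0 \<longleftrightarrow> vderiv \<gamma> t = 0" for t
    using \<omega>_birkhoff_nonzero[OF tangent_\<gamma> \<eta>_nz] bb.zero_right by (auto simp: A_def)
  have K_zero: "K t = 0 \<longleftrightarrow> vderiv \<eta> t = 0" for t
    using \<omega>_birkhoff_nonzero[OF tangent_\<eta> \<eta>_nz] bb.zero_right by (auto simp: K_def)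
  have cusp: "ordinary_cusp \<gamma> t \<longleftrightarrow> A t = 0" for t
    using assms(6) by (auto simp: generic_front_def A_zero ordinary_cusp_def singular_point_def)
  have A_deriv: "(A has_real_derivative A' t) (at t)" for t
    unfolding A_def[abs_def] A'_def has_real_derivative_iff_has_vector_derivative
    by (intro bb.has_vector_derivative smooth_curve_derivs \<gamma> \<eta>)
  have K_deriv: "(K has_real_derivative
      \<omega> (\<eta> t) (vderiv (vderiv \<eta>) t) + \<omega> (vderiv \<eta> t) (vderiv \<eta> t)) (at t)" for t
    unfolding K_def[abs_def] has_real_derivative_iff_has_vector_derivative
    by (intro bb.has_vector_derivative smooth_curve_derivs \<eta>)
  \<comment> \<open>At a cusp \<open>\<gamma>''\<close> is a limit of difference quotients of \<open>\<gamma>'\<close>, which are Birkhoff orthogonal to \<open>\<eta>\<close>; so is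
    \<open>\<gamma>''\<close> itself, and as it is nonzero it is not parallel to \<open>\<eta>\<close>.\<close>
  have A'_nz: "A' t \<noteq> 0" if "A t = 0" for t
  proof -
    have sing: "vderiv \<gamma> t = 0" using that A_zero by simp
    have "lin_indep2 ((vderiv ^^ 2) \<gamma> t) ((vderiv ^^ 3) \<gamma> t)"
      using that cusp by (auto simp: ordinary_cusp_def)
    then have "(vderiv ^^ 2) \<gamma> t \<noteq> 0"
      unfolding lin_indep2_def by (metis dependent_zero insertI1)
    then have nz: "vderiv (vderiv \<gamma>) t \<noteq> 0"
      by (simp add: numeral_2_eq_2)
    have "birkhoff_orth (\<eta> s) (vderiv \<gamma> s /\<^sub>R (s - t))" for s
      by (intro birkhoff_orth_scaleR tangent_\<gamma>)
    moreover have "(\<eta> \<longlongrightarrow> \<eta> t) (at t)"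
      using has_vector_derivative_continuous[OF smooth_curve_derivs(1)[OF \<eta>(2)]]
      by (simp add: continuous_at)
    moreover have "((\<lambda>s. vderiv \<gamma> s /\<^sub>R (s - t)) \<longlongrightarrow> vderiv (vderiv \<gamma>) t) (at t)"
      using has_vector_derivative_slope[OF smooth_curve_derivs(2)[OF \<gamma>(2), of t]] sing by simp
    ultimately have "birkhoff_orth (\<eta> t) (vderiv (vderiv \<gamma>) t)"
      by (rule birkhoff_orth_tendsto) simp
    from \<omega>_birkhoff_nonzero[OF this \<eta>_nz nz] show ?thesis
      by (simp add: A'_def sing bb.zero_right)
  qed
  interpret transverse_loop A K A'
  proof
    show "continuous_on UNIV A"
      by (rule DERIV_continuous_on) (rule A_deriv)
    show "continuous_on UNIV K"
      by (rule DERIV_continuous_on) (rule K_deriv)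
    show "periodic1 A" "periodic1 K"
      using \<eta>(1) vderiv_periodic1[OF \<gamma>(2,1)] vderiv_periodic1[OF \<eta>(2,1)]
      by (simp_all add: periodic1_def A_def K_def)
    show "A t \<noteq> 0 \<or> K t \<noteq> 0" for t using immersion A_zero K_zero by blast
  qed (use A_deriv A'_nz in auto)
  have k: "k_map \<omega> \<gamma> \<eta> t = proj_point (A t) (K t)" for t
  proof -
    define b where "b = xi \<omega> \<eta> t"
    have b: "b \<noteq> 0" "\<omega> (\<eta> t) b > 0" "\<And>w. birkhoff_orth (\<eta> t) w \<Longrightarrow> \<exists>c. w = c *\<^sub>R b"
      using bvec_spans_birkhoff_orth[OF assms(2) unit[of t]] by (auto simp: b_def xi_def)
    obtain \<alpha> \<kappa> where curv: "vderiv \<gamma> t = \<alpha> *\<^sub>R b" "vderiv \<eta> t = \<kappa> *\<^sub>R b"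
      using b(3) tangent_\<gamma> tangent_\<eta> by meson
    have "curv_alpha \<omega> \<gamma> \<eta> t = \<alpha>" "curv_kappa \<omega> \<eta> t = \<kappa>"
      using b(1) by (auto simp: curv_alpha_def curv_kappa_def curv b_def)
    moreover have "A t = \<omega> (\<eta> t) b * \<alpha>" "K t = \<omega> (\<eta> t) b * \<kappa>"
      by (simp_all add: A_def K_def curv \<omega>_expand)
    ultimately show ?thesis
      using b(2) proj_point_scale[of "\<omega> (\<eta> t) b"] by (simp add: k_map_def)
  qed
  have word: "cusp_word \<omega> \<gamma> \<eta> = crossing_word"
    unfolding cusp_word_def crossing_word_def cusp
    by (simp add: zig_def crossing_letter_def K_def)
  have "2 * int (zigzag_number \<omega> \<gamma> \<eta>) = \<bar>alternating_sum crossing_word\<bar>"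
    unfolding zigzag_number_def word
    by (rule even_word_reduced_length[OF rotation_number_crossing_word(1)])
  then have "2 * real (zigzag_number \<omega> \<gamma> \<eta>) = \<bar>alternating_sum crossing_word\<bar>"
    by linarith
  moreover have "k_map \<omega> \<gamma> \<eta> = (\<lambda>t. proj_point (A t) (K t))"
    using k by (rule ext)
  ultimately show ?thesis
    using rotation_number_crossing_word(2) by simp
qed

end
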